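(* Let $X,Y$ be compact Hausdorff spaces and let $E,F$ be Banach spaces over $\mathbb{K}$, where $F$ is strictly convex. Let $A$ be a completely regular $\mathbb{K}$-linear subspace of $C(X,E)$ and let $B$ be a $\mathbb{K}$-linear subspace of $C(Y,F)$. Then for any surjective (not necessarily linear) isometry $T:A\to B$ there exist a subset $Y_0$ of $Y$, a continuous surjection $\Phi:Y_0\to X$ and a collection $\{V_y\}_{y\in Y_0}$ of real-linear operators from $E$ to $F$ with $\|V_y\|=1$ for all $y\in Y_0$ such that $$Tf(y)=T0(y)+V_y(f(\Phi(y)))\qquad (f\in A,\ y\in Y_0).$$
   Context: $\mathbb{K}$ denotes $\mathbb{R}$ or $\mathbb{C}$. Compact Hausdorff spaces are nonempty and Banach spaces are nonzero. $C(X,E)$ is the Banach space of continuous $E$-valued functions on $X$ with the supremum norm $\|\cdot\|_\infty$. An isometry is a map with $\|Tf-Tg\|_\infty=\|f-g\|_\infty$ for all $f,g\in A$. $S(E)$ is the unit sphere of $E$. A subspace $A$ of $C(X,E)$ is completely regular if for each $x\in X$, each $u\in S(E)$ and each closed subset $C$ of $X$ not containing $x$, there exists $f\in A$ with $f(x)=u$, $\|f\|_\infty=1$ and $f(z)=0$ for every $z\in C$. *)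

theory Defs
  imports "HOL-Analysis.Analysis"
begin

text \<open>The scalar field is \<open>\<real>\<close> or \<open>\<complex>\<close>: a normed field extension of \<open>\<real>\<close>
  (with \<^term>\<open>norm (a * b) = norm a * norm b\<close>) that is either \<open>\<real>\<close> itself or of the form
  \<open>\<real> + \<real> i\<close> with \<open>i\<^sup>2 = -1\<close>. The multiplicative norm is then the usual absolute value.\<close>

class real_or_complex = real_normed_field +
  assumes real_or_complex:
    "(\<forall>z. \<exists>a. z = a *\<^sub>R 1) \<or> (\<exists>i. i * i = - 1 \<and> (\<forall>z. \<exists>a b. z = a *\<^sub>R 1 + b *\<^sub>R i))"

instance real :: real_or_complex
  by standard simp

instance complex :: real_or_complex
proof
  have "\<i> * \<i> = (- 1 :: complex) \<and> (\<forall>z. \<exists>a b. z = a *\<^sub>R 1 + b *\<^sub>R \<i>)"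
    by (auto simp: complex_eq_iff)
  then show "(\<forall>z::complex. \<exists>a. z = a *\<^sub>R 1) \<or>
      (\<exists>i::complex. i * i = - 1 \<and> (\<forall>z. \<exists>a b. z = a *\<^sub>R 1 + b *\<^sub>R i))"
    by blast
qed

text \<open>A Banach space over \<open>'k\<close> is a type of class \<^class>\<open>banach\<close> (a real Banach space) with a scalar
  multiplication \<open>s\<close> by \<open>'k\<close> extending the real one. The assumption \<open>nonzero\<close> reflects
  the convention that Banach spaces are nonzero.\<close>

locale banach_space_over = vector_space s
  for s :: "'k::real_or_complex \<Rightarrow> 'e::banach \<Rightarrow> 'e" +
  assumes scale_of_real: "s (of_real r) v = r *\<^sub>R v"
    and norm_scale: "norm (s c v) = norm c * norm v"
    and nonzero: "\<exists>v::'e. v \<noteq> 0"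

text \<open>On a compact space, \<^typ>\<open>'x \<Rightarrow>\<^sub>C 'e\<close> is the space of all continuous functions
  with the supremum norm. The scalar multiplication by \<open>'k\<close> on it is pointwise.\<close>

definition scale_fun :: "('k \<Rightarrow> 'e \<Rightarrow> 'e) \<Rightarrow> 'k \<Rightarrow> ('x::topological_space \<Rightarrow>\<^sub>C 'e::real_normed_vector)
    \<Rightarrow> ('x \<Rightarrow>\<^sub>C 'e)"
  where "scale_fun s c f = Bcontfun (\<lambda>x. s c (apply_bcontfun f x))"

context banach_space_over
begin

lemma bounded_linear_scale: "bounded_linear (s c)"
proof (rule bounded_linear_intro[where K = "norm c"])
  show "s c (r *\<^sub>R v) = r *\<^sub>R s c v" for r v
    by (metis mult.commute scale_of_real scale_scale)
qed (simp_all add: scale_right_distrib norm_scale mult.commute)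

lemma apply_scale_fun [simp]: "apply_bcontfun (scale_fun s c f) x = s c (apply_bcontfun f x)"
proof -
  have "(\<lambda>x. s c (apply_bcontfun f x)) \<in> bcontfun"
    using bounded_linear_image[OF bounded_apply_bcontfun[of f] bounded_linear_scale[of c]]
      bounded_linear.continuous_on[OF bounded_linear_scale[of c] continuous_on_apply_bcontfun[of UNIV f]]
    by (auto simp: bcontfun_def image_image)
  then show ?thesis
    by (simp add: scale_fun_def Bcontfun_inverse)
qed

lemma vector_space_scale_fun: "vector_space (scale_fun s)"
  by standard (auto intro!: bcontfun_eqI simp: scale_right_distrib scale_left_distrib)

end

definition strictly_convex :: "'f::real_normed_vector itself \<Rightarrow> bool"
  where "strictly_convex _ \<longleftrightarrow>
    (\<forall>u v :: 'f. norm u = 1 \<longrightarrow> norm v = 1 \<longrightarrow> u \<noteq> v \<longrightarrow> norm (u + v) < 2)"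

definition completely_regular :: "('x::topological_space \<Rightarrow>\<^sub>C 'e::real_normed_vector) set \<Rightarrow> bool"
  where "completely_regular A \<longleftrightarrow>
    (\<forall>x u C. norm u = 1 \<longrightarrow> closed C \<longrightarrow> x \<notin> C \<longrightarrow>
      (\<exists>f\<in>A. apply_bcontfun f x = u \<and> norm f = 1 \<and> (\<forall>z\<in>C. apply_bcontfun f z = 0)))"

end

theory Submission
  imports Defs
begin

text \<open>By the Mazur--Ulam theorem \<open>L f = T f - T 0\<close> is a real-linear isometry of \<open>A\<close> onto \<open>B\<close>.
  Fix \<open>x\<close> and a unit vector \<open>u\<close>. Since sums of \<open>n\<close> functions of norm 1 with value \<open>u\<close> at \<open>x\<close>
  have norm \<open>n\<close>, compactness of \<open>Y\<close> and strict convexity of \<open>F\<close> give a point \<open>y\<close> at which the images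
  \<open>L f\<close> of all such functions take one common value \<open>v\<close>, a unit vector. If \<open>f x = 0\<close> and \<open>\<parallel>f\<parallel> \<le> 1\<close>,
  adding \<open>\<plusminus> f\<close> to such a function supported where \<open>f\<close> is small shows \<open>\<parallel>v \<plusminus> L f y\<parallel> \<le> 1 + \<epsilon>\<close>
  for every \<open>\<epsilon> > 0\<close>, and strict convexity forces \<open>L f y = 0\<close>. Hence \<open>L f y\<close> depends only
  on \<open>f x\<close>. The points \<open>y\<close> that admit such an \<open>x\<close> form \<open>Y\<^sub>0\<close>.\<close>

section \<open>The Mazur--Ulam theorem on subspaces\<close>

text \<open>Nica's argument: conjugating the point reflection that swaps \<open>f a\<close> and \<open>f b\<close> gives an isometry
  \<open>g\<close> of \<open>A\<close> whose midpoint defect is twice that of \<open>f\<close>. All defects are at most \<open>\<parallel>a - b\<parallel> / 2\<close>,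
  so iterating shows that they vanish.\<close>

lemma reflection_doubles_midpoint_defect:
  fixes f :: "'a::real_normed_vector \<Rightarrow> 'b::real_normed_vector"
  assumes A: "subspace A" and B: "subspace (f ` A)"
    and iso: "\<And>x y. x \<in> A \<Longrightarrow> y \<in> A \<Longrightarrow> norm (f x - f y) = norm (x - y)"
    and ab: "a \<in> A" "b \<in> A"
  defines "g \<equiv> \<lambda>x. inv_into A f (f a + f b - f x)"
  shows "g ` A = A"
    and "\<And>x y. x \<in> A \<Longrightarrow> y \<in> A \<Longrightarrow> norm (g x - g y) = norm (x - y)"
    and "norm (g ((1/2) *\<^sub>R (a + b)) - (1/2) *\<^sub>R (g a + g b))
      = 2 * norm (f ((1/2) *\<^sub>R (a + b)) - (1/2) *\<^sub>R (f a + f b))"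
proof -
  have inj: "inj_on f A"
    using iso by (intro inj_onI) fastforce
  have refl: "f a + f b - f x \<in> f ` A" if "x \<in> A" for x
    using B ab that by (intro subspace_diff subspace_add) auto
  have gA: "g x \<in> A" and fg: "f (g x) = f a + f b - f x" if "x \<in> A" for x
    using refl[OF that] by (auto simp: g_def inv_into_into f_inv_into_f)
  have gg: "g (g x) = x" if "x \<in> A" for x
    using inj that gA[OF that] fg[OF that] by (simp add: g_def)
  show "g ` A = A"
    using gA gg by (auto simp: image_iff) metis
  show "norm (g x - g y) = norm (x - y)" if "x \<in> A" "y \<in> A" for x y
    using iso[OF gA gA, OF that] iso[OF that] that by (simp add: fg norm_minus_commute)
  define m where "m = (1/2) *\<^sub>R (a + b)"
  have m: "m \<in> A"
    using A ab by (auto simp: m_def intro!: subspace_scale subspace_add)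
  \<comment> \<open>\<open>g\<close> swaps \<open>a\<close> and \<open>b\<close>, so its midpoint
    defect is \<open>norm (g m - m)\<close>; applying \<open>f\<close> turns this displacement into
    twice the defect of \<open>f\<close>.\<close>
  have ga: "g a = b" and gb: "g b = a"
    using ab inj by (auto simp: g_def)
  have "norm (g m - m) = norm (f (g m) - f m)"
    using iso gA m by simp
  also have "f (g m) - f m = (-2) *\<^sub>R (f m - (1/2) *\<^sub>R (f a + f b))"
    by (simp add: fg m scaleR_2 algebra_simps)
  finally show "norm (g ((1/2) *\<^sub>R (a + b)) - (1/2) *\<^sub>R (g a + g b))
      = 2 * norm (f ((1/2) *\<^sub>R (a + b)) - (1/2) *\<^sub>R (f a + f b))"
    by (simp add: ga gb m_def add.commute)
qed

lemma isometry_midpoint_defect_bound: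
  fixes g :: "'a::real_normed_vector \<Rightarrow> 'a"
  assumes A: "subspace A" and ab: "a \<in> A" "b \<in> A"
    and "g ` A = A"
    and "\<And>x y. x \<in> A \<Longrightarrow> y \<in> A \<Longrightarrow> norm (g x - g y) = norm (x - y)"
  shows "2 ^ n * norm (g ((1/2) *\<^sub>R (a + b)) - (1/2) *\<^sub>R (g a + g b)) \<le> norm (a - b) / 2"
  using assms(4,5)
proof (induction n arbitrary: g)
  case 0
  define m where "m = (1/2) *\<^sub>R (a + b)"
  have m: "m \<in> A"
    using A ab by (auto simp: m_def intro!: subspace_scale subspace_add)
  \<comment> \<open>\<open>m\<close> is at distance \<open>norm (a - b) / 2\<close> from both
    endpoints, hence so is \<open>g m\<close> from their images; averaging the two differences
    bounds the defect.\<close>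
  have "m - a = (1/2) *\<^sub>R (b - a)" "m - b = (1/2) *\<^sub>R (a - b)"
    by (simp_all add: m_def algebra_simps flip: scaleR_add_left)
  then have "norm (g m - g a) = norm (a - b) / 2" "norm (g m - g b) = norm (a - b) / 2"
    using 0(2)[OF m ab(1)] 0(2)[OF m ab(2)] by (simp_all add: norm_minus_commute)
  moreover have "g m - (1/2) *\<^sub>R (g a + g b) = (1/2) *\<^sub>R ((g m - g a) + (g m - g b))"
    by (simp add: algebra_simps flip: scaleR_add_left)
  ultimately have "norm (g m - (1/2) *\<^sub>R (g a + g b)) \<le> norm (a - b) / 2"
    using norm_triangle_ineq[of "g m - g a" "g m - g b"] by simp
  then show ?case by (simp add: m_def)
next
  case (Suc n)
  have B: "subspace (g ` A)"
    using A Suc.prems(1) by simp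
  \<comment> \<open>The reflected map is again an isometry of \<open>A\<close> onto itself, so the
    induction hypothesis, stated for arbitrary \<open>g\<close>, applies to it; its doubled defect
    supplies the extra factor 2.\<close>
  note r = reflection_doubles_midpoint_defect[OF A B Suc.prems(2) ab]
  show ?case
    using Suc.IH[OF r(1,2)] r(3) by simp
qed

theorem mazur_ulam_midpoint:
  fixes f :: "'a::real_normed_vector \<Rightarrow> 'b::real_normed_vector"
  assumes A: "subspace A" and B: "subspace (f ` A)"
    and iso: "\<And>x y. x \<in> A \<Longrightarrow> y \<in> A \<Longrightarrow> norm (f x - f y) = norm (x - y)"
    and ab: "a \<in> A" "b \<in> A"
  shows "f ((1/2) *\<^sub>R (a + b)) = (1/2) *\<^sub>R (f a + f b)"
proof (rule ccontr)
  define d where "d = norm (f ((1/2) *\<^sub>R (a + b)) - (1/2) *\<^sub>R (f a + f b))"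
  assume "\<not> ?thesis"
  then have d: "d > 0" by (simp add: d_def)
  note r = reflection_doubles_midpoint_defect[OF A B iso ab]
  have bd: "2 ^ n * (2 * d) \<le> norm (a - b) / 2" for n
    using isometry_midpoint_defect_bound[OF A ab r(1,2)] r(3) by (simp add: d_def)
  obtain n where "norm (a - b) / 2 / (2 * d) < 2 ^ n"
    using real_arch_pow[of 2] by auto
  then show False
    using bd[of n] d by (simp add: field_simps)
qed

lemma additive_bounded_real_imp_scaleR:
  fixes g :: "real \<Rightarrow> 'a::real_normed_vector"
  assumes add: "\<And>r s. g (r + s) = g r + g s"
    and bd: "\<And>r. norm (g r) \<le> C * \<bar>r\<bar>"
  shows "g r = r *\<^sub>R g 1"
proof -
  \<comment> \<open>\<open>h\<close> is additive and 1-periodic, hence bounded, hence zero.\<close>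
  define h where "h r = g r - r *\<^sub>R g 1" for r
  define D where "D = C + norm (g 1)"
  have hadd: "h (r + s) = h r + h s" for r s
    by (simp add: h_def add algebra_simps)
  interpret h: additive h
    by standard (rule hadd)
  have hbd: "norm (h r) \<le> D * \<bar>r\<bar>" for r
    using norm_triangle_ineq4[of "g r" "r *\<^sub>R g 1"] bd[of r]
    by (simp add: h_def D_def algebra_simps)
  have hn: "h (of_nat n * r) = of_nat n *\<^sub>R h r" for n r
    by (induction n) (simp_all add: h.zero h.add algebra_simps)
  have h1: "h 1 = 0" by (simp add: h_def)
  have hz: "h (of_int k) = 0" for k
    using hn[of "nat k" 1] hn[of "nat (- k)" 1] h.minus[of "of_int k"] h1
    by (cases "k \<ge> 0") simp_all
  have D: "D \<ge> 0" using hbd[of 1] norm_ge_zero[of "h 1"] by linarith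
  \<comment> \<open>The integer part of \<open>of_nat n * r\<close> contributes nothing to
    \<open>h\<close>, so these multiples stay below \<open>D\<close> for every \<open>n\<close>,
    which forces \<open>h r = 0\<close>.\<close>
  have "of_nat n * norm (h r) \<le> D" for n
  proof -
    have "h (of_nat n * r) = h (frac (of_nat n * r))"
      by (simp add: frac_def h.diff hz)
    then have "of_nat n * norm (h r) = norm (h (frac (of_nat n * r)))"
      by (metis abs_of_nat hn norm_scaleR)
    also have "\<dots> \<le> D * \<bar>frac (of_nat n * r)\<bar>" by (rule hbd)
    also have "\<dots> \<le> D"
      using D frac_lt_1[of "of_nat n * r"] by (intro mult_left_le) auto
    finally show ?thesis .
  qed
  then have "norm (h r) = 0"
    by (metis linorder_not_le norm_ge_zero order_le_less real_archimedian_rdiv_eq_0 reals_Archimedean3 D)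
  then show ?thesis by (simp add: h_def)
qed

theorem mazur_ulam_linear:
  fixes f :: "'a::real_normed_vector \<Rightarrow> 'b::real_normed_vector"
  assumes A: "subspace A" and B: "subspace (f ` A)"
    and iso: "\<And>x y. x \<in> A \<Longrightarrow> y \<in> A \<Longrightarrow> norm (f x - f y) = norm (x - y)"
    and f0: "f 0 = 0"
  shows "\<And>a b. a \<in> A \<Longrightarrow> b \<in> A \<Longrightarrow> f (a + b) = f a + f b"
    and "\<And>r a. a \<in> A \<Longrightarrow> f (r *\<^sub>R a) = r *\<^sub>R f a"
proof -
  have A0: "0 \<in> A" using A by (rule subspace_0)
  show add: "f (a + b) = f a + f b" if "a \<in> A" "b \<in> A" for a b
  proof -
    have ab: "a + b \<in> A" using A that by (rule subspace_add)
    \<comment> \<open>Both sides are the value of \<open>f\<close> at the midpoint of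
      \<open>a\<close> and \<open>b\<close>, which is also the midpoint of \<open>a + b\<close> and
      0.\<close>
    have "(1/2) *\<^sub>R f (a + b) = (1/2) *\<^sub>R (f a + f b)"
      using mazur_ulam_midpoint[OF A B iso ab A0] mazur_ulam_midpoint[OF A B iso that] f0 by simp
    then show ?thesis by simp
  qed
  show "f (r *\<^sub>R a) = r *\<^sub>R f a" if "a \<in> A" for r a
  proof -
    have rA: "r *\<^sub>R a \<in> A" for r using A that by (rule subspace_scale)
    have "f (r *\<^sub>R a) = r *\<^sub>R f (1 *\<^sub>R a)"
    proof (rule additive_bounded_real_imp_scaleR)
      show "f ((r + s) *\<^sub>R a) = f (r *\<^sub>R a) + f (s *\<^sub>R a)" for r s
        by (simp add: scaleR_left_distrib add rA)
      show "norm (f (r *\<^sub>R a)) \<le> norm a * \<bar>r\<bar>" for r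
        using iso[OF rA A0, of r] f0 by (simp add: mult.commute)
    qed
    then show ?thesis by simp
  qed
qed

section \<open>Linear isometries of completely regular spaces\<close>

text \<open>The triangle inequality forces both norms to be 1, so a condition on the unit sphere
  becomes usable for vectors known only to lie in the closed ball.\<close>

lemma strictly_convex_eqI:
  fixes u v :: "'f::real_normed_vector"
  assumes "strictly_convex TYPE('f)" "norm u \<le> 1" "norm v \<le> 1" "2 \<le> norm (u + v)"
  shows "u = v" "norm u = 1"
proof -
  have "norm u = 1" "norm v = 1"
    using norm_triangle_ineq[of u v] assms by linarith+
  then show "u = v" "norm u = 1"
    using assms by (auto simp: strictly_convex_def) fastforce
qed

lemma bcontfun_norm_attained:
  fixes f :: "'y::topological_space \<Rightarrow>\<^sub>C 'f::real_normed_vector"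
  assumes "compact (UNIV :: 'y set)"
  obtains y where "norm (apply_bcontfun f y) = norm f"
proof -
  have "continuous_on UNIV (\<lambda>y. norm (apply_bcontfun f y))"
    by (intro continuous_intros continuous_on_apply_bcontfun)
  then obtain y where "\<And>z. norm (apply_bcontfun f z) \<le> norm (apply_bcontfun f y)"
    using continuous_attains_sup[OF assms] by auto
  then have "norm f \<le> norm (apply_bcontfun f y)"
    by (rule norm_bound)
  then show ?thesis
    using norm_bounded[of f y] that by fastforce
qed

lemma completely_regularE:
  assumes "completely_regular A" "norm u = 1" "closed C" "x \<notin> C"
  obtains f where "f \<in> A" "apply_bcontfun f x = u" "norm f = 1" "\<And>z. z \<in> C \<Longrightarrow> apply_bcontfun f z = 0"
  using assms unfolding completely_regular_def by metis

lemma completely_regular_extension: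
  assumes A: "completely_regular A" "subspace A"
  obtains f where "f \<in> A" "apply_bcontfun f x = e" "norm f = norm e"
proof (cases "e = 0")
  case True
  then show ?thesis using that[of 0] A(2) by (simp add: subspace_0)
next
  case False
  then have "norm (sgn e) = 1" by (simp add: norm_sgn)
  with A(1) obtain f where f: "f \<in> A" "apply_bcontfun f x = sgn e" "norm f = 1"
    by (rule completely_regularE[where C = "{}" and x = x]) auto
  show ?thesis
  proof
    show "norm e *\<^sub>R f \<in> A" using A(2) f(1) by (rule subspace_scale)
  qed (use False f in \<open>simp_all add: sgn_div_norm\<close>)
qed

locale linear_isometry_into_strictly_convex =
  fixes A :: "('x::t2_space \<Rightarrow>\<^sub>C 'e::real_normed_vector) set"
    and L :: "('x \<Rightarrow>\<^sub>C 'e) \<Rightarrow> ('y::topological_space \<Rightarrow>\<^sub>C 'f::real_normed_vector)"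
  assumes compact_Y: "compact (UNIV :: 'y set)"
    and strictly_convex: "strictly_convex TYPE('f)"
    and subspace_A: "subspace A"
    and completely_regular_A: "completely_regular A"
    and L_add: "\<And>f g. f \<in> A \<Longrightarrow> g \<in> A \<Longrightarrow> L (f + g) = L f + L g"
    and L_scaleR: "\<And>r f. f \<in> A \<Longrightarrow> L (r *\<^sub>R f) = r *\<^sub>R L f"
    and norm_L: "\<And>f. f \<in> A \<Longrightarrow> norm (L f) = norm f"
begin

definition peaks :: "'x \<Rightarrow> 'e \<Rightarrow> ('x \<Rightarrow>\<^sub>C 'e) set"
  where "peaks x u = {f \<in> A. apply_bcontfun f x = u \<and> norm f = 1}"

text \<open>\<open>localized y x\<close> says that \<open>y\<close> lies in \<open>Y\<^sub>0\<close> and \<open>\<Phi> y = x\<close>.\<close>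

definition localized :: "'y \<Rightarrow> 'x \<Rightarrow> bool"
  where "localized y x \<longleftrightarrow>
    (\<forall>f\<in>A. apply_bcontfun f x = 0 \<longrightarrow> apply_bcontfun (L f) y = 0) \<and>
    (\<exists>f\<in>A. norm f = 1 \<and> norm (apply_bcontfun f x) = 1 \<and> norm (apply_bcontfun (L f) y) = 1)"

section \<open>Common peak points of the images\<close>

lemma L_sum:
  assumes "finite G" "G \<subseteq> A"
  shows "sum id G \<in> A \<and> L (sum id G) = sum L G"
  using assms
proof (induction G)
  case empty
  then show ?case
    using L_scaleR[of 0 0] subspace_0[OF subspace_A] by simp
next
  case (insert f G)
  then show ?case
    using L_add[of f "sum id G"] subspace_add[OF subspace_A, of f "sum id G"] by simp
qed

lemma norm_L_le: "f \<in> A \<Longrightarrow> norm (apply_bcontfun (L f) y) \<le> norm f"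
  using norm_bounded[of "L f" y] norm_L by metis

lemma apply_sum_bcontfun: "apply_bcontfun (sum g I) x = (\<Sum>i\<in>I. apply_bcontfun (g i) x)"
  by (induction I rule: infinite_finite_induct) simp_all

text \<open>At a point where the image of a suitable sum attains its norm, \<open>card G\<close>
  vectors of norm at most 2 add up to norm at least \<open>2 * card G\<close>; so each has norm
  exactly 2.\<close>

lemma L_common_peak_finite:
  assumes u: "norm u = 1" and f0: "f0 \<in> peaks x u" and G: "finite G" "G \<subseteq> peaks x u"
  shows "\<exists>y. \<forall>f\<in>G. norm (apply_bcontfun (L f0) y + apply_bcontfun (L f) y) = 2"
proof -
  \<comment> \<open>The \<open>card G\<close> copies of \<open>f0\<close> pair every member of
    \<open>G\<close> with one reference function, to which strict convexity can later compare all
    values.\<close>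
  define S where "S = sum id G + real (card G) *\<^sub>R f0"
  have GA: "G \<subseteq> A" using G by (auto simp: peaks_def)
  have f0A: "f0 \<in> A" using f0 by (auto simp: peaks_def)
  have SA: "S \<in> A"
    using L_sum[OF G(1) GA] f0A subspace_A
    by (auto simp: S_def intro!: subspace_add subspace_scale)
  have LS: "L S = sum L G + real (card G) *\<^sub>R L f0"
    using L_sum[OF G(1) GA] f0A subspace_A
    by (auto simp: S_def L_add L_scaleR subspace_scale)
  have "apply_bcontfun S x = (\<Sum>f\<in>G. u) + real (card G) *\<^sub>R u"
    using f0 G unfolding S_def
    by (auto simp: apply_sum_bcontfun peaks_def intro!: sum.cong)
  then have "apply_bcontfun S x = (2 * real (card G)) *\<^sub>R u"
    by (simp add: sum_constant_scaleR flip: scaleR_add_left)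
  then have "2 * real (card G) \<le> norm S"
    using norm_bounded[of S x] u by simp
  moreover obtain y where "norm (apply_bcontfun (L S) y) = norm (L S)"
    using bcontfun_norm_attained[OF compact_Y] .
  moreover have "apply_bcontfun (L S) y = (\<Sum>f\<in>G. apply_bcontfun (L f0) y + apply_bcontfun (L f) y)"
    by (simp add: LS apply_sum_bcontfun sum.distrib sum_constant_scaleR)
  ultimately have "2 * real (card G) \<le> norm (\<Sum>f\<in>G. apply_bcontfun (L f0) y + apply_bcontfun (L f) y)"
    using norm_L[OF SA] by simp
  also have "\<dots> \<le> (\<Sum>f\<in>G. norm (apply_bcontfun (L f0) y + apply_bcontfun (L f) y))"
    by (rule norm_sum)
  finally have ge: "(\<Sum>f\<in>G. 2) \<le> (\<Sum>f\<in>G. norm (apply_bcontfun (L f0) y + apply_bcontfun (L f) y))"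
    by simp
  have le: "norm (apply_bcontfun (L f0) y + apply_bcontfun (L f) y) \<le> 2" if "f \<in> G" for f
    using norm_triangle_ineq[of "apply_bcontfun (L f0) y" "apply_bcontfun (L f) y"]
      norm_L_le[of f0 y] norm_L_le[of f y] f0 G that by (force simp: peaks_def)
  have eq: "(\<Sum>f\<in>G. norm (apply_bcontfun (L f0) y + apply_bcontfun (L f) y)) = (\<Sum>f\<in>G. 2)"
    by (rule antisym[OF sum_mono[OF le] ge])
  have "norm (apply_bcontfun (L f0) y + apply_bcontfun (L f) y) = 2" if "f \<in> G" for f
    using eq le that G(1) by (rule sum_mono_inv)
  then show ?thesis by blast
qed

text \<open>The finite case and compactness give one \<open>y\<close> for all peaks; strict
  convexity then makes every value equal to that of \<open>L f0\<close>, which serves as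
  \<open>v\<close>.\<close>

lemma L_common_peak:
  assumes u: "norm u = 1"
  obtains y v where "norm v = 1" "\<And>f. f \<in> peaks x u \<Longrightarrow> apply_bcontfun (L f) y = v"
proof -
  obtain f0 where f0: "f0 \<in> peaks x u"
    using completely_regularE[OF completely_regular_A u, of "{}" x] by (auto simp: peaks_def)
  define K where "K f = {y. norm (apply_bcontfun (L f0) y + apply_bcontfun (L f) y) = 2}" for f
  have "UNIV \<inter> (\<Inter>f\<in>peaks x u. K f) \<noteq> {}"
  proof (rule compact_imp_fip_image[OF compact_Y])
    show "closed (K f)" for f
      unfolding K_def by (intro closed_Collect_eq continuous_intros continuous_on_apply_bcontfun)
    show "UNIV \<inter> (\<Inter>f\<in>G. K f) \<noteq> {}" if "finite G" "G \<subseteq> peaks x u" for G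
      using L_common_peak_finite[OF u f0 that] by (auto simp: K_def)
  qed
  then obtain y where y: "\<And>f. f \<in> peaks x u \<Longrightarrow> y \<in> K f"
    by blast
  have eq: "apply_bcontfun (L f0) y = apply_bcontfun (L f) y" "norm (apply_bcontfun (L f0) y) = 1"
    if "f \<in> peaks x u" for f
  proof -
    have "norm (apply_bcontfun (L f0) y) \<le> 1" "norm (apply_bcontfun (L f) y) \<le> 1"
      using f0 that norm_L_le[of f0 y] norm_L_le[of f y] by (auto simp: peaks_def)
    then show "apply_bcontfun (L f0) y = apply_bcontfun (L f) y" "norm (apply_bcontfun (L f0) y) = 1"
      using strictly_convex_eqI[OF strictly_convex] y[OF that] by (auto simp: K_def)
  qed
  show ?thesis
    by (rule that[OF eq(2)[OF f0]]) (simp add: eq(1))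
qed

text \<open>This yields surjectivity of \<open>\<Phi>\<close>. A single unit vector \<open>u\<close>
  suffices: at its common peak point, \<open>L f\<close> already vanishes for every \<open>f\<close>
  in \<open>A\<close> with value 0 at \<open>x\<close>.\<close>

lemma ex_localized:
  assumes E: "\<exists>u::'e. u \<noteq> 0"
  shows "\<exists>y. localized y x"
proof -
  obtain u :: 'e where u: "norm u = 1"
    using E norm_sgn by metis
  obtain y v where v: "norm v = 1" and y: "\<And>f. f \<in> peaks x u \<Longrightarrow> apply_bcontfun (L f) y = v"
    using L_common_peak[OF u] by blast
  have small: "norm (v + apply_bcontfun (L f) y) \<le> 1 + e"
    if f: "f \<in> A" "apply_bcontfun f x = 0" "norm f \<le> 1" and e: "e > 0" for f e
  proof -
    \<comment> \<open>On \<open>C\<close> the function \<open>h\<close> chosen below vanishes and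
      \<open>f\<close> has norm at most 1; off \<open>C\<close> the norm of \<open>f\<close> is
      below \<open>e\<close>. Hence \<open>h + f\<close> stays within \<open>1 + e\<close>.\<close>
    define C where "C = {z. e \<le> norm (apply_bcontfun f z)}"
    have "closed C"
      unfolding C_def by (intro closed_Collect_le continuous_intros continuous_on_apply_bcontfun)
    moreover have "x \<notin> C" using f e by (simp add: C_def)
    ultimately obtain h where h: "h \<in> A" "apply_bcontfun h x = u" "norm h = 1"
      and h0: "\<And>z. z \<in> C \<Longrightarrow> apply_bcontfun h z = 0"
      using completely_regularE[OF completely_regular_A u] by metis
    have "norm (apply_bcontfun (h + f) z) \<le> 1 + e" for z
    proof (cases "z \<in> C")
      case True
      then show ?thesis
        using h0 norm_bounded[of f z] f e by simp
    next
      case False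
      then show ?thesis
        using norm_triangle_ineq[of "apply_bcontfun h z" "apply_bcontfun f z"]
          norm_bounded[of h z] h by (simp add: C_def)
    qed
    then have "norm (h + f) \<le> 1 + e" by (rule norm_bound)
    moreover have "apply_bcontfun (L (h + f)) y = v + apply_bcontfun (L f) y"
      using y[of h] h f by (simp add: L_add peaks_def)
    ultimately show ?thesis
      using norm_L_le[of "h + f" y] subspace_add[OF subspace_A h(1) f(1)] by simp
  qed
  have zero: "apply_bcontfun (L f) y = 0"
    if f: "f \<in> A" "apply_bcontfun f x = 0" "norm f \<le> 1" for f
  proof -
    define w where "w = apply_bcontfun (L f) y"
    have mf: "- f \<in> A" "L (- f) = - L f"
      using subspace_neg[OF subspace_A f(1)] L_scaleR[OF f(1), of "-1"] by simp_all
    have "norm (v + w) \<le> 1"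
      unfolding w_def using small[OF f] by (rule field_le_epsilon)
    moreover have "norm (v - w) \<le> 1"
    proof (rule field_le_epsilon)
      show "norm (v - w) \<le> 1 + e" if "e > 0" for e
        using small[of "- f" e] mf f that by (simp add: w_def)
    qed
    \<comment> \<open>The two vectors lie in the unit ball and add up to
      \<open>2 *\<^sub>R v\<close>, so strict convexity identifies them.\<close>
    moreover have "2 \<le> norm ((v + w) + (v - w))"
      using v by (simp flip: scaleR_2)
    ultimately have "v + w = v - w"
      using strictly_convex_eqI(1)[OF strictly_convex] by blast
    then have "2 *\<^sub>R w = 0" by (simp add: scaleR_2 algebra_simps)
    then show ?thesis by (simp add: w_def)
  qed
  have "apply_bcontfun (L f) y = 0" if f: "f \<in> A" "apply_bcontfun f x = 0" for f
  proof (cases "f = 0")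
    case True
    then show ?thesis using L_scaleR[OF f(1), of 0] by simp
  next
    case False
    have "apply_bcontfun (L ((1 / norm f) *\<^sub>R f)) y = 0"
      using f False by (intro zero subspace_scale[OF subspace_A]) simp_all
    then show ?thesis using f False by (simp add: L_scaleR)
  qed
  moreover obtain h where "h \<in> A" "apply_bcontfun h x = u" "norm h = 1"
    using completely_regular_extension[OF completely_regular_A subspace_A] u by metis
  moreover from this have "apply_bcontfun (L h) y = v"
    using y by (simp add: peaks_def)
  ultimately show ?thesis
    using u v unfolding localized_def by metis
qed

section \<open>The base point and the operator of a localized point\<close>

lemma localized_eqI:
  assumes "localized y x" "f \<in> A" "g \<in> A" "apply_bcontfun f x = apply_bcontfun g x"
  shows "apply_bcontfun (L f) y = apply_bcontfun (L g) y"
proof -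
  have "L (f + (-1) *\<^sub>R g) = L f - L g"
    using assms subspace_scale[OF subspace_A, of g "-1"] by (simp only: L_add L_scaleR) simp
  moreover have "f + (-1) *\<^sub>R g \<in> A"
    using assms subspace_A by (intro subspace_add subspace_scale)
  ultimately show ?thesis
    using assms(1,4) unfolding localized_def by force
qed

text \<open>By \<open>localized_eqI\<close> the witness in \<open>localized\<close> may be replaced
  by a function with the same value at \<open>x\<close> that vanishes off \<open>U\<close>. Both
  uniqueness of \<open>x\<close> and continuity of \<open>\<Phi>\<close> come from this.\<close>

lemma localized_nonvanishing_neighbourhood:
  assumes "localized y x" "open U" "x \<in> U"
  obtains f where "f \<in> A" "apply_bcontfun (L f) y \<noteq> 0" "\<And>z. z \<notin> U \<Longrightarrow> apply_bcontfun f z = 0"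
proof -
  obtain h where h: "h \<in> A" "norm (apply_bcontfun h x) = 1" "norm (apply_bcontfun (L h) y) = 1"
    using assms(1) unfolding localized_def by blast
  obtain f where f: "f \<in> A" "apply_bcontfun f x = apply_bcontfun h x"
      "\<And>z. z \<notin> U \<Longrightarrow> apply_bcontfun f z = 0"
    using completely_regularE[OF completely_regular_A h(2), of "- U" x] assms(2,3) by auto
  show ?thesis
    using f h localized_eqI[OF assms(1) f(1) h(1) f(2)] by (intro that[of f]) auto
qed

lemma localized_unique:
  assumes "localized y x" "localized y x'"
  shows "x = x'"
proof (rule ccontr)
  assume "x \<noteq> x'"
  then obtain U where "open U" "x \<in> U" "x' \<notin> U"
    using t1_space by blast
  with assms(1) obtain f where "f \<in> A" "apply_bcontfun (L f) y \<noteq> 0" "apply_bcontfun f x' = 0"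
    by (metis localized_nonvanishing_neighbourhood)
  then show False
    using assms(2) unfolding localized_def by blast
qed

lemma localized_operator:
  assumes "localized y x"
  obtains V :: "'e \<Rightarrow>\<^sub>L 'f" where "norm V = 1"
    "\<And>f. f \<in> A \<Longrightarrow> apply_bcontfun (L f) y = blinfun_apply V (apply_bcontfun f x)"
proof -
  obtain ext where ext: "\<And>e. ext e \<in> A" "\<And>e. apply_bcontfun (ext e) x = e" "\<And>e. norm (ext e) = norm e"
  proof -
    have "\<exists>f. f \<in> A \<and> apply_bcontfun f x = e \<and> norm f = norm e" for e
      using completely_regular_extension[OF completely_regular_A subspace_A] by blast
    then show ?thesis using that by metis
  qed
  \<comment> \<open>The choice \<open>ext\<close> may be nonlinear: by \<open>localized_eqI\<close>
    only the value at \<open>x\<close> counts, which makes \<open>V\<close> linear, while norm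
    preservation by \<open>ext\<close> gives \<open>V_le\<close>.\<close>
  define V where "V e = apply_bcontfun (L (ext e)) y" for e
  have LV: "apply_bcontfun (L f) y = V (apply_bcontfun f x)" if "f \<in> A" for f
    unfolding V_def using assms that ext by (intro localized_eqI) auto
  have V_le: "norm (V e) \<le> norm e * 1" for e
    using norm_L_le[OF ext(1)] ext(3) by (simp add: V_def)
  have V: "bounded_linear V"
  proof (rule bounded_linear_intro[OF _ _ V_le])
    show "V (a + b) = V a + V b" for a b
      using LV[of "ext a + ext b"] ext subspace_add[OF subspace_A] by (simp add: L_add V_def)
    show "V (r *\<^sub>R a) = r *\<^sub>R V a" for r a
      using LV[of "r *\<^sub>R ext a"] ext subspace_scale[OF subspace_A] by (simp add: L_scaleR V_def)
  qed
  obtain h where h: "h \<in> A" "norm (apply_bcontfun h x) = 1" "norm (apply_bcontfun (L h) y) = 1"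
    using assms unfolding localized_def by blast
  \<comment> \<open>The second conjunct of \<open>localized\<close> gives the lower bound, since
    \<open>V\<close> sends the unit vector \<open>apply_bcontfun h x\<close> to a unit
    vector.\<close>
  have "norm (Blinfun V) = 1"
    using h V_le by (intro norm_blinfun_eqI[where x = "apply_bcontfun h x"])
      (simp_all add: bounded_linear_Blinfun_apply[OF V] LV)
  then show ?thesis
    using LV by (intro that[of "Blinfun V"]) (simp_all add: bounded_linear_Blinfun_apply[OF V])
qed

theorem representation:
  assumes E: "\<exists>u::'e. u \<noteq> 0"
  obtains Y\<^sub>0 :: "'y set" and \<Phi> :: "'y \<Rightarrow> 'x" and V :: "'y \<Rightarrow> 'e \<Rightarrow>\<^sub>L 'f"
  where "continuous_on Y\<^sub>0 \<Phi>" "\<Phi> ` Y\<^sub>0 = UNIV" "\<And>y. y \<in> Y\<^sub>0 \<Longrightarrow> norm (V y) = 1"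
    "\<And>f y. f \<in> A \<Longrightarrow> y \<in> Y\<^sub>0 \<Longrightarrow>
      apply_bcontfun (L f) y = blinfun_apply (V y) (apply_bcontfun f (\<Phi> y))"
proof -
  define Y\<^sub>0 where "Y\<^sub>0 = {y. \<exists>x. localized y x}"
  \<comment> \<open>On \<open>Y\<^sub>0\<close> the description is unique by
    \<open>localized_unique\<close>; elsewhere the value is unspecified.\<close>
  define \<Phi> where "\<Phi> y = (THE x. localized y x)" for y
  have Phi_eq: "\<Phi> y = x" if "localized y x" for x y
    using that localized_unique by (auto simp: \<Phi>_def)
  then have Phi: "localized y (\<Phi> y)" if "y \<in> Y\<^sub>0" for y
    using that by (auto simp: Y\<^sub>0_def)
  have cont: "continuous_on Y\<^sub>0 \<Phi>"
    unfolding continuous_on_topological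
  proof (intro ballI allI impI)
    fix y U assume y: "y \<in> Y\<^sub>0" and U: "open U" "\<Phi> y \<in> U"
    obtain f where f: "f \<in> A" "apply_bcontfun (L f) y \<noteq> 0" "\<And>z. z \<notin> U \<Longrightarrow> apply_bcontfun f z = 0"
      using localized_nonvanishing_neighbourhood[OF Phi[OF y] U] by blast
    \<comment> \<open>This is the required neighbourhood: if \<open>\<Phi> z\<close> lay outside
      \<open>U\<close>, then \<open>f\<close> would vanish there and localization would make
      \<open>L f\<close> vanish at \<open>z\<close>.\<close>
    have "open {z. apply_bcontfun (L f) z \<noteq> 0}"
      by (intro open_Collect_neq continuous_intros continuous_on_apply_bcontfun)
    moreover have "\<Phi> z \<in> U" if "z \<in> Y\<^sub>0" "apply_bcontfun (L f) z \<noteq> 0" for z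
      using Phi[OF that(1)] f that(2) unfolding localized_def by blast
    ultimately show "\<exists>W. open W \<and> y \<in> W \<and> (\<forall>z\<in>Y\<^sub>0. z \<in> W \<longrightarrow> \<Phi> z \<in> U)"
      using f(2) by (intro exI[of _ "{z. apply_bcontfun (L f) z \<noteq> 0}"]) auto
  qed
  have "x \<in> \<Phi> ` Y\<^sub>0" for x
    using ex_localized[OF E] Phi_eq by (auto simp: Y\<^sub>0_def image_iff) metis
  then have surj: "\<Phi> ` Y\<^sub>0 = UNIV" by auto
  have "\<forall>y. \<exists>V :: 'e \<Rightarrow>\<^sub>L 'f. y \<in> Y\<^sub>0 \<longrightarrow> norm V = 1 \<and>
      (\<forall>f\<in>A. apply_bcontfun (L f) y = blinfun_apply V (apply_bcontfun f (\<Phi> y)))"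
    using localized_operator[OF Phi] by metis
  then obtain V :: "'y \<Rightarrow> 'e \<Rightarrow>\<^sub>L 'f" where "\<forall>y. y \<in> Y\<^sub>0 \<longrightarrow> norm (V y) = 1 \<and>
      (\<forall>f\<in>A. apply_bcontfun (L f) y = blinfun_apply (V y) (apply_bcontfun f (\<Phi> y)))"
    by metis
  with cont surj show ?thesis
    by (intro that[of Y\<^sub>0 \<Phi> V]) auto
qed

end

section \<open>Reduction of the given isometry to the real-linear case\<close>

lemma (in banach_space_over) real_subspace:
  assumes "module.subspace (scale_fun s) (A :: ('x::topological_space \<Rightarrow>\<^sub>C 'e) set)"
  shows "Real_Vector_Spaces.subspace A"
proof -
  interpret fs: vector_space "scale_fun s :: 'k \<Rightarrow> ('x \<Rightarrow>\<^sub>C 'e) \<Rightarrow> _"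
    by (rule vector_space_scale_fun)
  have "r *\<^sub>R f = scale_fun s (of_real r) f" for r and f :: "'x \<Rightarrow>\<^sub>C 'e"
    by (rule bcontfun_eqI) (simp add: scale_of_real)
  then show ?thesis
    using assms by (auto simp: Real_Vector_Spaces.subspace_def fs.subspace_def)
qed

theorem corollary3p8:
  fixes sE :: "'k::real_or_complex \<Rightarrow> 'e::banach \<Rightarrow> 'e"
    and sF :: "'k \<Rightarrow> 'f::banach \<Rightarrow> 'f"
    and A :: "('x::t2_space \<Rightarrow>\<^sub>C 'e) set"
    and B :: "('y::t2_space \<Rightarrow>\<^sub>C 'f) set"
    and T :: "('x \<Rightarrow>\<^sub>C 'e) \<Rightarrow> ('y \<Rightarrow>\<^sub>C 'f)"
  assumes "compact (UNIV :: 'x set)" and "compact (UNIV :: 'y set)"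
    and "banach_space_over sE" and "banach_space_over sF"
    and "strictly_convex TYPE('f)"
    and "module.subspace (scale_fun sE) A" and "completely_regular A"
    and "module.subspace (scale_fun sF) B"
    and "T ` A = B"
    and "\<And>f g. f \<in> A \<Longrightarrow> g \<in> A \<Longrightarrow> norm (T f - T g) = norm (f - g)"
  shows "\<exists>(Y\<^sub>0 :: 'y set) (\<Phi> :: 'y \<Rightarrow> 'x) (V :: 'y \<Rightarrow> 'e \<Rightarrow>\<^sub>L 'f).
    continuous_on Y\<^sub>0 \<Phi> \<and> \<Phi> ` Y\<^sub>0 = UNIV \<and> (\<forall>y\<in>Y\<^sub>0. norm (V y) = 1) \<and>
    (\<forall>f\<in>A. \<forall>y\<in>Y\<^sub>0. apply_bcontfun (T f) y =
      apply_bcontfun (T 0) y + blinfun_apply (V y) (apply_bcontfun f (\<Phi> y)))"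
proof -
  interpret E: banach_space_over sE by fact
  interpret F: banach_space_over sF by fact
  have A: "subspace A" and B: "subspace B"
    using assms E.real_subspace F.real_subspace by blast+
  have A0: "0 \<in> A" using A by (rule subspace_0)
  define L where "L f = T f - T 0" for f
  have T0: "T 0 \<in> B" using assms(9) A0 by blast
  have "L ` A = B"
  proof -
    \<comment> \<open>Since \<open>T 0\<close> lies in the subspace \<open>B\<close>, translation by
      it preserves \<open>B\<close>; so the image of \<open>L\<close> is a subspace, as Mazur--Ulam
      requires.\<close>
    have "L ` A = (\<lambda>g. g - T 0) ` B"
      by (auto simp: L_def simp flip: assms(9))
    also have "\<dots> = B"
      using subspace_add[OF B _ T0] subspace_diff[OF B _ T0]
      by (auto simp: image_iff) (metis add_diff_cancel_right')
    finally show ?thesis .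
  qed
  then have LA: "subspace (L ` A)" using B by simp
  have L_iso: "norm (L f - L g) = norm (f - g)" if "f \<in> A" "g \<in> A" for f g
    using assms(10)[OF that] by (simp add: L_def)
  have L0: "L 0 = 0" by (simp add: L_def)
  interpret linear_isometry_into_strictly_convex A L
  proof
    show "norm (L f) = norm f" if "f \<in> A" for f
      using L_iso[OF that A0] L0 by simp
    show "L (f + g) = L f + L g" if "f \<in> A" "g \<in> A" for f g
      using A LA L_iso L0 that by (rule mazur_ulam_linear(1))
    show "L (r *\<^sub>R f) = r *\<^sub>R L f" if "f \<in> A" for r f
      using A LA L_iso L0 that by (rule mazur_ulam_linear(2))
  qed (fact assms A)+
  obtain Y\<^sub>0 :: "'y set" and \<Phi> :: "'y \<Rightarrow> 'x" and V :: "'y \<Rightarrow> 'e \<Rightarrow>\<^sub>L 'f"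
    where "continuous_on Y\<^sub>0 \<Phi>" "\<Phi> ` Y\<^sub>0 = UNIV" "\<And>y. y \<in> Y\<^sub>0 \<Longrightarrow> norm (V y) = 1"
      and "\<And>f y. f \<in> A \<Longrightarrow> y \<in> Y\<^sub>0 \<Longrightarrow>
        apply_bcontfun (L f) y = blinfun_apply (V y) (apply_bcontfun f (\<Phi> y))"
    using representation[OF E.nonzero] by blast
  moreover have "apply_bcontfun (T f) y = apply_bcontfun (T 0) y + apply_bcontfun (L f) y" for f y
    by (simp add: L_def)
  ultimately show ?thesis by metis
qed

end
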